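(* Let $p\in[1,2]$, let $D$ be a non-empty convex subset of $B^0_{p,1}$, let $Y$ be a Banach space and $F\colon D\to Y$. Suppose that $(\tilde\phi_\lambda)_{\lambda\in\Lambda}$ is a Riesz basis of $L^2(\Omega)$, and that for some $a>0$ and $L_2>0$ $$\|F(f_1)-F(f_2)\|_Y\le L_2\|f_1-f_2\|_{-a,2,1}\qquad\text{for all }f_1,f_2\in D.$$ Suppose that $D$ contains the Besov ball $$K^s_{p,q}(\bar f,\varrho):=\{f\in B^s_{p,q}\colon\|f-\bar f\|_{s,p,q}\le\varrho\}$$ for some $q\in[1,\infty]$, $s>0$, $\bar f\in B^s_{p,q}$ and $\varrho>0$. Then there is no (linear or nonlinear) map $R\colon Y\to B^0_{p,1}$ whose worst case error $$\Delta_R(\delta):=\sup\left\{\|f-R(g^{\mathrm{obs}})\|_{0,p,1}\colon f\in K^s_{p,q}(\bar f,\varrho),\ g^{\mathrm{obs}}\in Y,\ \|F(f)-g^{\mathrm{obs}}\|_Y\le\delta\right\}$$ satisfies $\Delta_R(\delta)=o\left(\varrho^{\frac{a}{s+a}}\delta^{\frac{s}{s+a}}\right)$ as $\delta\searrow0$.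
   Context: $\Omega$ is either a bounded Lipschitz domain in $\mathbb{R}^d$ or the torus $(\mathbb{R}/\mathbb{Z})^d$. The index set is $\Lambda=\{(j,k)\colon j\in\mathbb{N}_0,k\in\Lambda_j\}$ with finite sets $\Lambda_j$ satisfying $2^{jd}\le|\Lambda_j|\le C_\Lambda2^{jd}$ for a constant $C_\Lambda\ge1$. $\{\phi_\lambda\}_{\lambda\in\Lambda}$ and $\{\tilde\phi_\lambda\}_{\lambda\in\Lambda}$ are wavelet frames in $L^2(\Omega)$ dual to each other, i.e. $\langle\phi_{j',k'},\tilde\phi_{j,k}\rangle_{L^2}=\delta_{jj'}\delta_{kk'}$, and each $\tilde\phi_\lambda$ belongs to $C^{\overline s}(\overline\Omega)$ for some $\overline s\in\mathbb{N}\cup\{\infty\}$. $\mathcal{D}^{\overline s}(\Omega)$ is the space of distributions of order $\le\overline s$ on $\mathbb{R}^d$ supported in $\overline\Omega$ (for the torus: periodic distributions of order $\le\overline s$). For $f\in\mathcal{D}^{\overline s}(\Omega)$ put $Q_jf:=(\langle f,\tilde\phi_{j,k}\rangle)_{k\in\Lambda_j}$. For $s\in\mathbb{R}$, $p,q\in[1,\infty]$ define the norm $$\|f\|_{s,p,q}:=\left\|\left(2^{js}2^{jd(\frac12-\frac1p)}\|Q_jf\|_p\right)_{j\in\mathbb{N}_0}\right\|_{\ell^q},$$ where $\|\cdot\|_p$ is the $\ell^p$-norm on $\mathbb{R}^{\Lambda_j}$, and $B^s_{p,q}:=\{f\in\mathcal{D}^{\overline s}(\Omega)\colon\|f\|_{s,p,q}<\infty\}$.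 *)

theory Defs
  imports "HOL-Analysis.Analysis"
begin

section \<open>Regions\<close>

definition bounded_lipschitz_domain :: "(real ^ 'n::finite) set \<Rightarrow> bool" where
  "bounded_lipschitz_domain S \<longleftrightarrow>
     S \<noteq> {} \<and> open S \<and> connected S \<and> bounded S \<and>
     (\<forall>x\<in>frontier S. \<exists>e U \<gamma> L. norm e = 1 \<and> open U \<and> x \<in> U \<and>
        L-lipschitz_on {y. y \<bullet> e = 0} \<gamma> \<and>
        S \<inter> U = {y \<in> U. \<gamma> (y - (y \<bullet> e) *\<^sub>R e) < y \<bullet> e})"

text \<open>Functions on the torus \<open>(\<real>/\<int>)\<^sup>d\<close> are represented by their \<open>\<int>\<^sup>d\<close>-periodic lifts
  to \<open>\<real>\<^sup>d\<close>, and \<open>d = CARD('n)\<close>.\<close>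

datatype ('n::finite) region = Domain "(real ^ 'n) set" | Torus

fun admissible_region :: "('n::finite) region \<Rightarrow> bool" where
  "admissible_region (Domain S) = bounded_lipschitz_domain S"
| "admissible_region Torus = True"

text \<open>The set carrying the measure of \<open>L\<^sup>2\<close>; for the torus a fundamental cell.\<close>

fun cell :: "('n::finite) region \<Rightarrow> (real ^ 'n) set" where
  "cell (Domain S) = S"
| "cell Torus = {x. \<forall>i. 0 \<le> x $ i \<and> x $ i < 1}"

text \<open>The points at which elements of \<open>C\<^sup>m\<close> of the closed region are evaluated; for the torus
  all of \<open>\<real>\<^sup>d\<close>, because of the periodic lift.\<close>

fun closed_region :: "('n::finite) region \<Rightarrow> (real ^ 'n) set" where
  "closed_region (Domain S) = closure S"
| "closed_region Torus = UNIV"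


section \<open>Functions of class \<open>C\<^sup>m\<close>\<close>

definition partial_deriv :: "'n \<Rightarrow> (real ^ 'n::finite \<Rightarrow> real) \<Rightarrow> real ^ 'n \<Rightarrow> real" where
  "partial_deriv i u x = frechet_derivative u (at x) (axis i 1)"

text \<open>A list of coordinates plays the role of a multi-index.\<close>

definition iterated_partial :: "'n list \<Rightarrow> (real ^ 'n::finite \<Rightarrow> real) \<Rightarrow> real ^ 'n \<Rightarrow> real" where
  "iterated_partial is u = foldr partial_deriv is u"

definition C_class :: "enat \<Rightarrow> (real ^ 'n::finite \<Rightarrow> real) \<Rightarrow> bool" where
  "C_class m u \<longleftrightarrow>
     (\<forall>is. enat (length is) \<le> m \<longrightarrow> continuous_on UNIV (iterated_partial is u)) \<and>
     (\<forall>is. enat (length is) < m \<longrightarrow> iterated_partial is u differentiable_on UNIV)"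

text \<open>Only used for functions all of whose derivatives up to order \<open>k\<close> are bounded.\<close>

definition C_norm :: "nat \<Rightarrow> (real ^ 'n::finite \<Rightarrow> real) \<Rightarrow> real" where
  "C_norm k u = (SUP (is, x) \<in> {is. length is \<le> k} \<times> UNIV. \<bar>iterated_partial is u x\<bar>)"

definition support :: "(real ^ 'n::finite \<Rightarrow> real) \<Rightarrow> (real ^ 'n) set" where
  "support u = closure {x. u x \<noteq> 0}"

fun test_functions :: "enat \<Rightarrow> ('n::finite) region \<Rightarrow> (real ^ 'n \<Rightarrow> real) set" where
  "test_functions m (Domain S) = {u. C_class m u \<and> compact (support u)}"
| "test_functions m Torus =
     {u. C_class m u \<and> (\<forall>z x. (\<forall>i. z $ i \<in> \<int>) \<longrightarrow> u (x + z) = u x)}"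

text \<open>\<open>C\<^sup>m\<close> of the closed region: restrictions of test functions on \<open>\<real>\<^sup>d\<close>.  For bounded Lipschitz
  domains this is the same (Whitney extension and cut-off) as all derivatives of order at most
  \<open>m\<close> in the interior having continuous extensions to the closure.\<close>

definition C_closed :: "enat \<Rightarrow> ('n::finite) region \<Rightarrow> (real ^ 'n \<Rightarrow> real) set" where
  "C_closed m \<Omega> = {v. \<exists>u\<in>test_functions m \<Omega>. \<forall>x\<in>closed_region \<Omega>. u x = v x}"


section \<open>Distributions of finite order\<close>

type_synonym 'n functional = "(real ^ 'n \<Rightarrow> real) \<Rightarrow> real"

text \<open>Following Schwartz, the distributions of order at most \<open>m\<close> on \<open>\<real>\<^sup>d\<close> are the continuous
  linear functionals on the space of compactly supported functions of class \<open>C\<^sup>m\<close>; for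
  \<open>m = \<infinity>\<close> these are all distributions.  Periodic distributions of order at most \<open>m\<close> are the
  continuous linear functionals on the periodic functions of class \<open>C\<^sup>m\<close>.  Functionals are
  normalized to \<open>0\<close> off the test functions, so that equality of distributions is equality in HOL
  and the pointwise operations are the vector space operations.\<close>

fun continuous_functional ::
    "enat \<Rightarrow> ('n::finite) region \<Rightarrow> 'n functional \<Rightarrow> bool" where
  "continuous_functional m (Domain S) f \<longleftrightarrow>
     (\<forall>K. compact K \<longrightarrow> (\<exists>C k. enat k \<le> m \<and>
        (\<forall>u\<in>test_functions m (Domain S). support u \<subseteq> K \<longrightarrow> \<bar>f u\<bar> \<le> C * C_norm k u)))"
| "continuous_functional m Torus f \<longleftrightarrow>
     (\<exists>C k. enat k \<le> m \<and> (\<forall>u\<in>test_functions m Torus. \<bar>f u\<bar> \<le> C * C_norm k u))"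

definition distributions :: "enat \<Rightarrow> ('n::finite) region \<Rightarrow> 'n functional set" where
  "distributions m \<Omega> = {f.
     (\<forall>u. u \<notin> test_functions m \<Omega> \<longrightarrow> f u = 0) \<and>
     (\<forall>u\<in>test_functions m \<Omega>. \<forall>v\<in>test_functions m \<Omega>. \<forall>a b.
        f (\<lambda>x. a * u x + b * v x) = a * f u + b * f v) \<and>
     continuous_functional m \<Omega> f \<and>
     (\<forall>u\<in>test_functions m \<Omega>. support u \<inter> closed_region \<Omega> = {} \<longrightarrow> f u = 0)}"

text \<open>The pairing with \<open>v\<close> in \<open>C\<^sup>m\<close> of the closed region.  The result does not depend on the
  extension chosen: the difference of two extensions vanishes on the open set \<open>\<Omega>\<close>, hence with all
  derivatives of order at most \<open>m\<close> on its closure, and is annihilated by every distribution of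
  order at most \<open>m\<close> supported there.\<close>

definition pairing ::
    "enat \<Rightarrow> ('n::finite) region \<Rightarrow> 'n functional \<Rightarrow> (real ^ 'n \<Rightarrow> real) \<Rightarrow> real" where
  "pairing m \<Omega> f v = f (SOME u. u \<in> test_functions m \<Omega> \<and> (\<forall>x\<in>closed_region \<Omega>. u x = v x))"


section \<open>\<open>L\<^sup>2\<close>, frames and Riesz bases\<close>

definition L2 :: "('n::finite) region \<Rightarrow> (real ^ 'n \<Rightarrow> real) set" where
  "L2 \<Omega> = {f. f \<in> borel_measurable (lebesgue_on (cell \<Omega>)) \<and>
              integrable (lebesgue_on (cell \<Omega>)) (\<lambda>x. (f x)\<^sup>2)}"

definition L2_inner ::
    "('n::finite) region \<Rightarrow> (real ^ 'n \<Rightarrow> real) \<Rightarrow> (real ^ 'n \<Rightarrow> real) \<Rightarrow> real" where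
  "L2_inner \<Omega> f g = (\<integral>x. f x * g x \<partial>lebesgue_on (cell \<Omega>))"

definition L2_norm :: "('n::finite) region \<Rightarrow> (real ^ 'n \<Rightarrow> real) \<Rightarrow> real" where
  "L2_norm \<Omega> f = sqrt (L2_inner \<Omega> f f)"

definition L2_frame ::
    "('n::finite) region \<Rightarrow> 'i set \<Rightarrow> ('i \<Rightarrow> real ^ 'n \<Rightarrow> real) \<Rightarrow> bool" where
  "L2_frame \<Omega> I \<psi> \<longleftrightarrow> (\<forall>i\<in>I. \<psi> i \<in> L2 \<Omega>) \<and>
     (\<exists>A>0. \<exists>B>0. \<forall>f\<in>L2 \<Omega>.
        ennreal (A * (L2_norm \<Omega> f)\<^sup>2) \<le> (\<Sum>\<^sub>\<infinity>i\<in>I. ennreal ((L2_inner \<Omega> f (\<psi> i))\<^sup>2)) \<and>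
        (\<Sum>\<^sub>\<infinity>i\<in>I. ennreal ((L2_inner \<Omega> f (\<psi> i))\<^sup>2)) \<le> ennreal (B * (L2_norm \<Omega> f)\<^sup>2))"

definition L2_riesz_basis ::
    "('n::finite) region \<Rightarrow> 'i set \<Rightarrow> ('i \<Rightarrow> real ^ 'n \<Rightarrow> real) \<Rightarrow> bool" where
  "L2_riesz_basis \<Omega> I \<psi> \<longleftrightarrow> (\<forall>i\<in>I. \<psi> i \<in> L2 \<Omega>) \<and>
     (\<forall>f\<in>L2 \<Omega>. \<forall>\<epsilon>>0. \<exists>J c. finite J \<and> J \<subseteq> I \<and>
        L2_norm \<Omega> (\<lambda>x. f x - (\<Sum>i\<in>J. c i * \<psi> i x)) < \<epsilon>) \<and>
     (\<exists>A>0. \<exists>B>0. \<forall>J c. finite J \<and> J \<subseteq> I \<longrightarrow>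
        A * (\<Sum>i\<in>J. (c i)\<^sup>2) \<le> (L2_norm \<Omega> (\<lambda>x. \<Sum>i\<in>J. c i * \<psi> i x))\<^sup>2 \<and>
        (L2_norm \<Omega> (\<lambda>x. \<Sum>i\<in>J. c i * \<psi> i x))\<^sup>2 \<le> B * (\<Sum>i\<in>J. (c i)\<^sup>2))"


section \<open>Besov spaces\<close>

text \<open>The norm of \<open>\<ell>\<^sup>p(A)\<close> for \<open>p \<in> [1, \<infinity>]\<close>, with value \<open>\<infinity>\<close> outside that space.\<close>

definition ell_norm :: "ennreal \<Rightarrow> 'i set \<Rightarrow> ('i \<Rightarrow> real) \<Rightarrow> ennreal" where
  "ell_norm p A x =
     (if p = \<infinity> then (SUP k\<in>A. ennreal \<bar>x k\<bar>)
      else (let S = (\<Sum>\<^sub>\<infinity>k\<in>A. ennreal (\<bar>x k\<bar> powr enn2real p))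
            in if S = \<infinity> then \<infinity> else ennreal (enn2real S powr (1 / enn2real p))))"

text \<open>In the following, \<open>\<Lambda> j\<close> is the finite index set of level \<open>j\<close> and \<open>\<psi> (j, k)\<close> is the dual
  wavelet with index \<open>(j, k)\<close>.\<close>

definition Q_coeff ::
    "enat \<Rightarrow> ('n::finite) region \<Rightarrow> (nat \<times> 'k \<Rightarrow> real ^ 'n \<Rightarrow> real) \<Rightarrow> nat \<Rightarrow>
     'n functional \<Rightarrow> 'k \<Rightarrow> real" where
  "Q_coeff m \<Omega> \<psi> j f k = pairing m \<Omega> f (\<psi> (j, k))"

text \<open>As \<open>\<Lambda> j\<close> is finite, the inner norm is finite and \<open>enn2real\<close> loses nothing; \<open>1 / p\<close> is \<open>0\<close>
  for \<open>p = \<infinity>\<close>.\<close>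

definition besov_norm ::
    "enat \<Rightarrow> ('n::finite) region \<Rightarrow> (nat \<Rightarrow> 'k set) \<Rightarrow> (nat \<times> 'k \<Rightarrow> real ^ 'n \<Rightarrow> real) \<Rightarrow>
     real \<Rightarrow> ennreal \<Rightarrow> ennreal \<Rightarrow> 'n functional \<Rightarrow> ennreal" where
  "besov_norm m \<Omega> \<Lambda> \<psi> s p q f =
     ell_norm q UNIV (\<lambda>j. 2 powr (real j * s)
       * 2 powr (real j * real CARD('n) * (1 / 2 - enn2real (1 / p)))
       * enn2real (ell_norm p (\<Lambda> j) (Q_coeff m \<Omega> \<psi> j f)))"

definition besov_space ::
    "enat \<Rightarrow> ('n::finite) region \<Rightarrow> (nat \<Rightarrow> 'k set) \<Rightarrow> (nat \<times> 'k \<Rightarrow> real ^ 'n \<Rightarrow> real) \<Rightarrow>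
     real \<Rightarrow> ennreal \<Rightarrow> ennreal \<Rightarrow> 'n functional set" where
  "besov_space m \<Omega> \<Lambda> \<psi> s p q =
     {f \<in> distributions m \<Omega>. besov_norm m \<Omega> \<Lambda> \<psi> s p q f < \<infinity>}"

definition besov_ball ::
    "enat \<Rightarrow> ('n::finite) region \<Rightarrow> (nat \<Rightarrow> 'k set) \<Rightarrow> (nat \<times> 'k \<Rightarrow> real ^ 'n \<Rightarrow> real) \<Rightarrow>
     real \<Rightarrow> ennreal \<Rightarrow> ennreal \<Rightarrow> 'n functional \<Rightarrow> real \<Rightarrow> 'n functional set" where
  "besov_ball m \<Omega> \<Lambda> \<psi> s p q fbar \<rho> =
     {f \<in> besov_space m \<Omega> \<Lambda> \<psi> s p q. besov_norm m \<Omega> \<Lambda> \<psi> s p q (f - fbar) \<le> ennreal \<rho>}"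

definition convex_functionals :: "('n::finite) functional set \<Rightarrow> bool" where
  "convex_functionals D \<longleftrightarrow>
     (\<forall>f\<in>D. \<forall>g\<in>D. \<forall>t\<in>{0..1}. (\<lambda>u. (1 - t) * f u + t * g u) \<in> D)"


section \<open>Worst case error\<close>

definition worst_case_error ::
    "('f::minus \<Rightarrow> ennreal) \<Rightarrow> 'f set \<Rightarrow> ('f \<Rightarrow> 'y::real_normed_vector) \<Rightarrow> ('y \<Rightarrow> 'f) \<Rightarrow>
     real \<Rightarrow> ennreal" where
  "worst_case_error N K F R \<delta> =
     (SUP (f, gobs) \<in> {(f, g). f \<in> K \<and> norm (F f - g) \<le> \<delta>}. N (f - R gobs))"

end

theory Submission
  imports Defs
begin

text \<open>Perturb \<open>fbar\<close> on a single level \<open>j\<close> by the multiple of \<open>\<Sum>k\<in>\<Lambda> j. \<phi> (j, k)\<close> that has norm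
  \<open>\<rho>\<close> in \<open>B\<^sup>s\<^bsub>p,q\<^esub>\<close>.  All its coefficients on level \<open>j\<close> are equal, so \<open>p \<le> 2\<close> and the lower bound on
  the number of wavelets make its norm in \<open>B\<^sup>-\<^sup>a\<^bsub>2,1\<^esub>\<close> at most \<open>\<rho> 2 powr (- j (s + a))\<close>, whereas
  its norm in \<open>B\<^sup>0\<^bsub>p,1\<^esub>\<close> is \<open>\<rho> 2 powr (- j s)\<close>.  With the noise level
  \<open>\<delta> j = L\<^sub>2 \<rho> 2 powr (- j (s + a))\<close> the data \<open>F fbar\<close> are admissible for both functions, and no
  reconstruction from them is close to both.  As \<open>\<rho> powr (a / (s + a)) * \<delta> j powr (s / (s + a))\<close> is
  a constant multiple of \<open>\<rho> 2 powr (- j s)\<close>, the ratio in question stays bounded away from \<open>0\<close>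
  along \<open>\<delta> j\<close>.\<close>

section \<open>Test functions\<close>

lemma iterated_partial_Nil [simp]: "iterated_partial [] u = u"
  and iterated_partial_Cons: "iterated_partial (i # is) u = partial_deriv i (iterated_partial is u)"
  by (simp_all add: iterated_partial_def)

lemma C_class_continuous:
  "C_class m u \<Longrightarrow> enat (length is) \<le> m \<Longrightarrow> continuous_on UNIV (iterated_partial is u)"
  by (simp add: C_class_def)

section \<open>Linear combinations of test functions\<close>

lemma partial_deriv_linear_combination:
  assumes "u differentiable (at x)" "v differentiable (at x)"
  shows "partial_deriv i (\<lambda>x. a * u x + b * v x) x = a * partial_deriv i u x + b * partial_deriv i v x"
proof -
  have u: "(u has_derivative frechet_derivative u (at x)) (at x)"
    and v: "(v has_derivative frechet_derivative v (at x)) (at x)"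
    using assms by (simp_all add: frechet_derivative_works)
  have "((\<lambda>x. a * u x + b * v x) has_derivative
      (\<lambda>h. a * frechet_derivative u (at x) h + b * frechet_derivative v (at x) h)) (at x)"
    by (intro has_derivative_add has_derivative_mult_right u v)
  from frechet_derivative_at[OF this] show ?thesis
    by (simp add: partial_deriv_def fun_eq_iff)
qed

text \<open>The tail of a list of length at most \<open>m\<close> has length strictly below
  \<open>m\<close>, where \<open>C_class\<close> provides differentiability, so the linearity of one
  partial derivative applies once more.\<close>

lemma iterated_partial_linear_combination:
  assumes "C_class m u" "C_class m v" "enat (length is) \<le> m"
  shows "iterated_partial is (\<lambda>x. a * u x + b * v x) =
    (\<lambda>x. a * iterated_partial is u x + b * iterated_partial is v x)"
  using assms(3)
proof (induction "is")
  case Nil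
  show ?case by simp
next
  case (Cons i "is")
  have lt: "enat (length is) < m"
    using Cons.prems by (metis Suc_ile_eq length_Cons)
  have "iterated_partial is u differentiable at x" "iterated_partial is v differentiable at x" for x
    using assms(1,2) lt by (auto simp: C_class_def differentiable_on_def)
  then show ?case
    unfolding iterated_partial_Cons Cons.IH[OF less_imp_le[OF lt]]
    by (intro ext partial_deriv_linear_combination)
qed

lemma C_class_linear_combination:
  assumes "C_class m u" "C_class m v"
  shows "C_class m (\<lambda>x. a * u x + b * v x)"
proof -
  have "continuous_on UNIV (iterated_partial is (\<lambda>x. a * u x + b * v x))" if "enat (length is) \<le> m" for "is"
    unfolding iterated_partial_linear_combination[OF assms that]
    using assms that by (intro continuous_intros) (auto simp: C_class_def)
  moreover have "iterated_partial is (\<lambda>x. a * u x + b * v x) differentiable_on UNIV"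
    if "enat (length is) < m" for "is"
    unfolding iterated_partial_linear_combination[OF assms less_imp_le[OF that]]
    using assms that
    by (auto simp: C_class_def differentiable_on_def)
  ultimately show ?thesis by (simp add: C_class_def)
qed

lemma test_functions_C_class: "u \<in> test_functions m \<Omega> \<Longrightarrow> C_class m u"
  by (cases \<Omega>) auto

lemma zero_outside_support: "x \<notin> support u \<Longrightarrow> u x = 0"
  using closure_subset[of "{x. u x \<noteq> 0}"] by (auto simp: support_def)

text \<open>Needed for the linearity of \<open>functional_of\<close>, which is cut off to 0 outside
  the test functions. On a domain, the new support is a closed subset of the compact union of the
  two supports.\<close>

lemma test_functions_linear_combination:
  assumes "u \<in> test_functions m \<Omega>" "v \<in> test_functions m \<Omega>"
  shows "(\<lambda>x. a * u x + b * v x) \<in> test_functions m \<Omega>"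
proof (cases \<Omega>)
  case (Domain S)
  have "support (\<lambda>x. a * u x + b * v x) \<subseteq> support u \<union> support v"
    unfolding support_def by (subst closure_Un[symmetric], rule closure_mono) auto
  moreover have "closed (support (\<lambda>x. a * u x + b * v x))"
    by (simp add: support_def)
  moreover have "compact (support u \<union> support v)"
    using assms Domain by auto
  ultimately have "compact (support (\<lambda>x. a * u x + b * v x))"
    by (metis compact_Int_closed inf.absorb_iff2)
  then show ?thesis
    using assms Domain by (simp add: C_class_linear_combination)
next
  case Torus
  then show ?thesis using assms by (simp add: C_class_linear_combination)
qed

section \<open>Boundedness of derivatives and of the set defining \<open>C_norm\<close>\<close>

lemma iterated_partial_zero_outside_support:
  "x \<notin> support u \<Longrightarrow> iterated_partial is u x = 0"
proof (induction "is" arbitrary: x)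
  case Nil
  then show ?case by (simp add: zero_outside_support)
next
  case (Cons i "is")
  \<comment> \<open>By openness the induction hypothesis, which holds for every point off the
    support, makes the lower derivative vanish in a whole neighbourhood of \<open>x\<close>.\<close>
  have "open (- support u)"
    by (simp add: support_def open_Compl)
  then have "(iterated_partial is u has_derivative (\<lambda>h. 0)) (at x)"
    by (rule has_derivative_transform_within_open[OF has_derivative_const[of 0]])
      (use Cons in auto)
  from frechet_derivative_at[OF this] show ?case
    by (simp add: iterated_partial_Cons partial_deriv_def fun_eq_iff)
qed

text \<open>An equivalence of the predicates, because \<open>frechet_derivative\<close> is a choice
  from \<open>has_derivative\<close>: the choices at \<open>x\<close> and \<open>x + z\<close> then
  agree even where no derivative exists.\<close>

lemma has_derivative_periodic:
  assumes "\<And>x. u (x + z) = u x"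
  shows "(u has_derivative f') (at (x + z)) \<longleftrightarrow> (u has_derivative f') (at x)"
proof
  assume "(u has_derivative f') (at (x + z))"
  moreover have "((\<lambda>x. x + z) has_derivative (\<lambda>h. h)) (at x)"
    by (auto intro!: derivative_eq_intros)
  ultimately have "((\<lambda>x. u (x + z)) has_derivative (\<lambda>h. f' h)) (at x)"
    using has_derivative_compose by blast
  then show "(u has_derivative f') (at x)" by (simp add: assms)
next
  assume "(u has_derivative f') (at x)"
  moreover have "((\<lambda>y. y - z) has_derivative (\<lambda>h. h)) (at (x + z))"
    by (auto intro!: derivative_eq_intros)
  ultimately have "((\<lambda>y. u (y - z)) has_derivative (\<lambda>h. f' h)) (at (x + z))"
    using has_derivative_compose[of "\<lambda>y. y - z" "\<lambda>h. h" "x + z" UNIV u f'] by simp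
  moreover have "u (y - z) = u y" for y
    using assms[of "y - z"] by simp
  ultimately show "(u has_derivative f') (at (x + z))" by simp
qed

lemma iterated_partial_periodic:
  assumes "\<And>x. u (x + z) = u x"
  shows "iterated_partial is u (x + z) = iterated_partial is u x"
proof (induction "is" arbitrary: x)
  case Nil
  show ?case by (simp add: assms)
next
  case (Cons i "is")
  have "frechet_derivative (iterated_partial is u) (at (x + z)) =
      frechet_derivative (iterated_partial is u) (at x)"
    using has_derivative_periodic[of "iterated_partial is u" z, OF Cons.IH]
    by (simp add: frechet_derivative_def)
  then show ?case
    by (simp add: iterated_partial_Cons partial_deriv_def)
qed

text \<open>Subtracting integer parts moves every point into the compact unit cube without changing
  the value.\<close>

lemma bounded_if_periodic:
  fixes v :: "real ^ 'n::finite \<Rightarrow> real"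
  assumes "continuous_on UNIV v" and "\<And>z x. (\<forall>i. z $ i \<in> \<int>) \<Longrightarrow> v (x + z) = v x"
  shows "bounded (range v)"
proof -
  have "v x \<in> v ` cbox 0 (\<chi> i. 1)" for x
  proof -
    have "v (x + (\<chi> i. - of_int \<lfloor>x $ i\<rfloor>)) = v x"
      by (rule assms(2)) auto
    moreover have "x + (\<chi> i. - of_int \<lfloor>x $ i\<rfloor>) \<in> cbox 0 (\<chi> i. 1)"
      by (auto simp: mem_box_cart) linarith
    ultimately show ?thesis by (metis imageI)
  qed
  moreover have "compact (v ` cbox 0 (\<chi> i. 1))"
    using assms(1) by (intro compact_continuous_image) (auto intro: continuous_on_subset)
  ultimately show ?thesis
    by (meson bounded_subset compact_imp_bounded image_subsetI)
qed

lemma bounded_iterated_partial: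
  assumes "u \<in> test_functions m \<Omega>" "enat (length is) \<le> m"
  shows "bounded (range (iterated_partial is u))"
proof (cases \<Omega>)
  case (Domain S)
  have "range (iterated_partial is u) \<subseteq> insert 0 (iterated_partial is u ` support u)"
    using iterated_partial_zero_outside_support by fastforce
  moreover have "compact (iterated_partial is u ` support u)"
    using assms Domain
    by (intro compact_continuous_image) (auto intro: continuous_on_subset C_class_continuous)
  ultimately show ?thesis
    by (meson bounded_insert bounded_subset compact_imp_bounded)
next
  case Torus
  with assms show ?thesis
    by (intro bounded_if_periodic C_class_continuous[of m] iterated_partial_periodic) auto
qed

text \<open>\<open>C_norm\<close> is a supremum in the reals and can only be estimated once this is
  known. There are finitely many lists of length at most \<open>k\<close>, and each of these
  derivatives is bounded.\<close>

lemma bdd_above_C_norm: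
  fixes u :: "real ^ 'n::finite \<Rightarrow> real"
  assumes "u \<in> test_functions m \<Omega>" "enat k \<le> m"
  shows "bdd_above ((\<lambda>(is, x). \<bar>iterated_partial is u x\<bar>) ` ({is. length is \<le> k} \<times> UNIV))"
proof -
  have "finite {is :: 'n list. length is \<le> k}"
    using finite_lists_length_le[of "UNIV :: 'n set" k] by simp
  moreover have "bdd_above (range (\<lambda>x. \<bar>iterated_partial is u x\<bar>))" if "length is \<le> k" for "is"
  proof -
    have "enat (length is) \<le> m"
      using that assms(2) by (meson enat_ord_simps(1) order_trans)
    from bounded_iterated_partial[OF assms(1) this] show ?thesis
      by (auto simp: bounded_iff bdd_above_def)
  qed
  ultimately have "bdd_above (\<Union>is\<in>{is. length is \<le> k}. range (\<lambda>x. \<bar>iterated_partial is u x\<bar>))"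
    by (simp add: bdd_above_UN)
  moreover have "(\<lambda>(is, x). \<bar>iterated_partial is u x\<bar>) ` ({is. length is \<le> k} \<times> UNIV) =
      (\<Union>is\<in>{is. length is \<le> k}. range (\<lambda>x. \<bar>iterated_partial is u x\<bar>))"
    by auto
  ultimately show ?thesis by simp
qed

lemma C_norm_mono:
  assumes "u \<in> test_functions m \<Omega>" "enat l \<le> m" "k \<le> l"
  shows "C_norm k u \<le> C_norm l u"
  unfolding C_norm_def
  by (rule cSUP_subset_mono[OF _ bdd_above_C_norm[OF assms(1,2)]])
    (use assms(3) in \<open>auto intro: exI[of _ "[]"]\<close>)

lemma abs_le_C_norm:
  assumes "u \<in> test_functions m \<Omega>"
  shows "\<bar>u x\<bar> \<le> C_norm 0 u"
proof -
  have "bdd_above ((\<lambda>(is, x). \<bar>iterated_partial is u x\<bar>) ` ({is. length is \<le> 0} \<times> UNIV))"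
    using assms by (rule bdd_above_C_norm) (simp flip: zero_enat_def)
  from cSUP_upper[OF _ this, of "([], x)"] show ?thesis
    by (simp add: C_norm_def)
qed


section \<open>Square integrable functions as distributions\<close>

text \<open>The value 0 off the test functions is the normalization that
  \<open>distributions\<close> demands.\<close>

definition functional_of ::
    "enat \<Rightarrow> ('n::finite) region \<Rightarrow> (real ^ 'n \<Rightarrow> real) \<Rightarrow> 'n functional" where
  "functional_of m \<Omega> h u = (if u \<in> test_functions m \<Omega> then L2_inner \<Omega> h u else 0)"

section \<open>The cell and integrability on it\<close>

lemma cell_subset_closed_region: "cell \<Omega> \<subseteq> closed_region \<Omega>"
  by (cases \<Omega>) (auto simp: closure_subset)

lemma cell_lmeasurable:
  fixes \<Omega> :: "'n::finite region"
  assumes "admissible_region \<Omega>"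
  shows "cell \<Omega> \<in> lmeasurable"
proof (cases \<Omega>)
  case (Domain S)
  then show ?thesis using assms
    by (auto simp: bounded_lipschitz_domain_def intro: lmeasurable_open)
next
  case Torus
  have "cell \<Omega> = (\<Inter>i. {x. 0 \<le> x $ i} \<inter> {x. x $ i < 1})"
    using Torus by auto
  also have "\<dots> \<in> sets borel"
    by measurable
  finally have "cell \<Omega> \<in> sets lebesgue" by simp
  moreover have "cell \<Omega> \<subseteq> cbox 0 (\<chi> i. 1)"
    using Torus by (auto simp: mem_box_cart less_imp_le)
  then have "bounded (cell \<Omega>)"
    using bounded_cbox bounded_subset by blast
  ultimately show ?thesis
    using bounded_set_imp_lmeasurable by blast
qed

lemma integrable_mult_L2:
  assumes "f \<in> L2 \<Omega>" "g \<in> L2 \<Omega>"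
  shows "integrable (lebesgue_on (cell \<Omega>)) (\<lambda>x. f x * g x)"
proof (rule Bochner_Integration.integrable_bound)
  show "integrable (lebesgue_on (cell \<Omega>)) (\<lambda>x. (f x)\<^sup>2 + (g x)\<^sup>2)"
    using assms by (simp add: L2_def)
  show "(\<lambda>x. f x * g x) \<in> borel_measurable (lebesgue_on (cell \<Omega>))"
    using assms by (auto simp: L2_def)
  have "\<bar>s * t\<bar> \<le> s\<^sup>2 + t\<^sup>2" for s t :: real
  proof -
    have "2 * \<bar>s\<bar> * \<bar>t\<bar> \<le> s\<^sup>2 + t\<^sup>2"
      using sum_squares_bound[of "\<bar>s\<bar>" "\<bar>t\<bar>"] by simp
    moreover have "0 \<le> \<bar>s\<bar> * \<bar>t\<bar>" by simp
    ultimately show ?thesis unfolding abs_mult by linarith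
  qed
  then show "AE x in lebesgue_on (cell \<Omega>). norm (f x * g x) \<le> norm ((f x)\<^sup>2 + (g x)\<^sup>2)"
    by simp
qed

text \<open>The cell has finite measure, so the constant 1 is in \<open>L2\<close>, and a product of
  two \<open>L2\<close> functions is integrable.\<close>

lemma integrable_L2:
  assumes "admissible_region \<Omega>" "h \<in> L2 \<Omega>"
  shows "integrable (lebesgue_on (cell \<Omega>)) h"
proof -
  have "finite_measure (lebesgue_on (cell \<Omega>))"
    using cell_lmeasurable[OF assms(1)] by (simp add: finite_measure_lebesgue_on)
  then have "(\<lambda>x. 1) \<in> L2 \<Omega>"
    by (simp add: L2_def finite_measure.integrable_const)
  from integrable_mult_L2[OF assms(2) this] show ?thesis by simp
qed

lemma integrable_mult_test_function:
  assumes "admissible_region \<Omega>" "integrable (lebesgue_on (cell \<Omega>)) h" "u \<in> test_functions m \<Omega>"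
  shows "integrable (lebesgue_on (cell \<Omega>)) (\<lambda>x. h x * u x)"
proof (rule Bochner_Integration.integrable_bound)
  show "integrable (lebesgue_on (cell \<Omega>)) (\<lambda>x. C_norm 0 u * h x)"
    using assms(2) by simp
  have "continuous_on UNIV u"
    using C_class_continuous[OF test_functions_C_class[OF assms(3)], of "[]"]
    by (simp flip: zero_enat_def)
  then have "u \<in> borel_measurable lebesgue"
    by (simp add: borel_measurable_continuous_onI measurable_completion)
  then have "u \<in> borel_measurable (lebesgue_on (cell \<Omega>))"
    by (rule measurable_restrict_space1)
  then show "(\<lambda>x. h x * u x) \<in> borel_measurable (lebesgue_on (cell \<Omega>))"
    using assms(2) by auto
  have "norm (h x * u x) \<le> norm (C_norm 0 u * h x)" for x
  proof -
    have "\<bar>u x\<bar> \<le> \<bar>C_norm 0 u\<bar>"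
      using abs_le_C_norm[OF assms(3), of x] by linarith
    from mult_left_mono[OF this abs_ge_zero[of "h x"]] show ?thesis
      by (simp add: abs_mult mult.commute)
  qed
  then show "AE x in lebesgue_on (cell \<Omega>). norm (h x * u x) \<le> norm (C_norm 0 u * h x)"
    by simp
qed

text \<open>An integrable density gives a functional of order 0: no derivative of \<open>u\<close>
  enters the bound.\<close>

lemma functional_of_le:
  assumes "admissible_region \<Omega>" "integrable (lebesgue_on (cell \<Omega>)) h" "u \<in> test_functions m \<Omega>"
  shows "\<bar>functional_of m \<Omega> h u\<bar> \<le> (\<integral>x. \<bar>h x\<bar> \<partial>lebesgue_on (cell \<Omega>)) * C_norm 0 u"
proof -
  have "\<bar>functional_of m \<Omega> h u\<bar> = \<bar>\<integral>x. h x * u x \<partial>lebesgue_on (cell \<Omega>)\<bar>"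
    using assms(3) by (simp add: functional_of_def L2_inner_def)
  also have "\<dots> \<le> (\<integral>x. \<bar>h x * u x\<bar> \<partial>lebesgue_on (cell \<Omega>))"
    by (rule integral_abs_bound)
  also have "\<dots> \<le> (\<integral>x. \<bar>h x\<bar> * C_norm 0 u \<partial>lebesgue_on (cell \<Omega>))"
  proof (intro integral_mono)
    show "integrable (lebesgue_on (cell \<Omega>)) (\<lambda>x. \<bar>h x * u x\<bar>)"
      using integrable_mult_test_function[OF assms] by (rule integrable_abs)
  qed (use assms(2) abs_le_C_norm[OF assms(3)] in \<open>auto simp: abs_mult intro: mult_left_mono\<close>)
  finally show ?thesis by simp
qed

lemma functional_of_eq_zero:
  assumes "support u \<inter> closed_region \<Omega> = {}"
  shows "functional_of m \<Omega> h u = 0"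
proof -
  have "u x = 0" if "x \<in> cell \<Omega>" for x
    using that assms cell_subset_closed_region[of \<Omega>] by (intro zero_outside_support) auto
  then have "L2_inner \<Omega> h u = (\<integral>x. 0 \<partial>lebesgue_on (cell \<Omega>))"
    unfolding L2_inner_def by (intro Bochner_Integration.integral_cong) auto
  then show ?thesis by (simp add: functional_of_def)
qed

text \<open>Whichever extension \<open>pairing\<close> chooses, it agrees with \<open>v\<close> on
  the closed region, which contains the cell, and the integral sees nothing else.\<close>

lemma pairing_functional_of:
  assumes "v \<in> C_closed m \<Omega>"
  shows "pairing m \<Omega> (functional_of m \<Omega> h) v = L2_inner \<Omega> h v"
proof -
  define u where "u = (SOME u. u \<in> test_functions m \<Omega> \<and> (\<forall>x\<in>closed_region \<Omega>. u x = v x))"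
  have u: "u \<in> test_functions m \<Omega> \<and> (\<forall>x\<in>closed_region \<Omega>. u x = v x)"
    using assms unfolding u_def C_closed_def Bex_def mem_Collect_eq by (rule someI_ex)
  have "L2_inner \<Omega> h u = L2_inner \<Omega> h v"
    unfolding L2_inner_def
    by (intro Bochner_Integration.integral_cong) (use u cell_subset_closed_region[of \<Omega>] in auto)
  then show ?thesis
    using u by (simp add: pairing_def functional_of_def flip: u_def)
qed

text \<open>The order 0 bound for the integral part is weakened to the order \<open>k\<close> that
  serves \<open>f\<close>; only the constant grows, by the integral of
  \<open>\<bar>h x\<bar>\<close>.\<close>

lemma add_functional_of_in_distributions:
  assumes "admissible_region \<Omega>" "integrable (lebesgue_on (cell \<Omega>)) h" "f \<in> distributions m \<Omega>"
  shows "(\<lambda>u. f u + functional_of m \<Omega> h u) \<in> distributions m \<Omega>"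
proof -
  let ?g = "functional_of m \<Omega> h"
  let ?I = "\<integral>x. \<bar>h x\<bar> \<partial>lebesgue_on (cell \<Omega>)"
  have lin: "?g (\<lambda>x. a * u x + b * v x) = a * ?g u + b * ?g v"
    if u: "u \<in> test_functions m \<Omega>" and v: "v \<in> test_functions m \<Omega>" for u v a b
  proof -
    note int = integrable_mult_test_function[OF assms(1,2) u] integrable_mult_test_function[OF assms(1,2) v]
    have "L2_inner \<Omega> h (\<lambda>x. a * u x + b * v x) =
        (\<integral>x. a * (h x * u x) + b * (h x * v x) \<partial>lebesgue_on (cell \<Omega>))"
      by (simp add: L2_inner_def algebra_simps)
    also have "\<dots> = a * L2_inner \<Omega> h u + b * L2_inner \<Omega> h v"
      using int by (simp add: L2_inner_def)
    finally show ?thesis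
      using u v by (simp add: functional_of_def test_functions_linear_combination)
  qed
  have le: "\<bar>f u + ?g u\<bar> \<le> (C + ?I) * C_norm k u"
    if "u \<in> test_functions m \<Omega>" "enat k \<le> m" "\<bar>f u\<bar> \<le> C * C_norm k u" for u C k
  proof -
    have "\<bar>?g u\<bar> \<le> ?I * C_norm 0 u"
      by (rule functional_of_le[OF assms(1,2) that(1)])
    also have "\<dots> \<le> ?I * C_norm k u"
      using C_norm_mono[OF that(1,2), of 0] by (intro mult_left_mono integral_nonneg) auto
    finally show ?thesis using that(3) by (simp add: distrib_right)
  qed
  have "continuous_functional m \<Omega> (\<lambda>u. f u + ?g u)"
  proof (cases \<Omega>)
    case (Domain S)
    show ?thesis
      unfolding Domain continuous_functional.simps
    proof (intro allI impI)
      fix K :: "(real ^ 'a) set" assume "compact K"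
      then obtain C k where k: "enat k \<le> m" and
        "\<forall>u\<in>test_functions m (Domain S). support u \<subseteq> K \<longrightarrow> \<bar>f u\<bar> \<le> C * C_norm k u"
        using assms(3) Domain by (auto simp: distributions_def)
      then have "\<forall>u\<in>test_functions m (Domain S). support u \<subseteq> K \<longrightarrow>
          \<bar>f u + functional_of m (Domain S) h u\<bar> \<le> (C + ?I) * C_norm k u"
        using le Domain by blast
      with k show "\<exists>C k. enat k \<le> m \<and> (\<forall>u\<in>test_functions m (Domain S). support u \<subseteq> K \<longrightarrow>
          \<bar>f u + functional_of m (Domain S) h u\<bar> \<le> C * C_norm k u)"
        by blast
    qed
  next
    case Torus
    then obtain C k where k: "enat k \<le> m" and
      "\<forall>u\<in>test_functions m Torus. \<bar>f u\<bar> \<le> C * C_norm k u"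
      using assms(3) by (auto simp: distributions_def)
    then have "\<forall>u\<in>test_functions m Torus. \<bar>f u + functional_of m Torus h u\<bar> \<le> (C + ?I) * C_norm k u"
      using le Torus by blast
    with k show ?thesis unfolding Torus continuous_functional.simps by blast
  qed
  moreover have "?g u = 0" if "u \<notin> test_functions m \<Omega>" for u
    using that by (simp add: functional_of_def)
  ultimately show ?thesis
    using assms(3) lin
    by (simp add: distributions_def functional_of_eq_zero algebra_simps)
qed


section \<open>Sequence norms\<close>

text \<open>In \<open>ennreal\<close> every family is summable, so a term splits off without side
  conditions.\<close>

lemma infsum_ennreal_remove:
  fixes x :: "'i \<Rightarrow> ennreal"
  assumes "i \<in> A"
  shows "(\<Sum>\<^sub>\<infinity>k\<in>A. x k) = x i + (\<Sum>\<^sub>\<infinity>k\<in>A - {i}. x k)"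
proof -
  have "(\<Sum>\<^sub>\<infinity>k\<in>{i} \<union> (A - {i}). x k) = (\<Sum>\<^sub>\<infinity>k\<in>{i}. x k) + (\<Sum>\<^sub>\<infinity>k\<in>A - {i}. x k)"
    by (rule infsum_Un_disjoint) (auto simp: nonneg_summable_on_complete)
  moreover have "{i} \<union> (A - {i}) = A" using assms by auto
  ultimately show ?thesis by simp
qed

lemma enn2real_ge_1: "1 \<le> p \<Longrightarrow> p \<noteq> \<infinity> \<Longrightarrow> 1 \<le> enn2real p"
  by (metis enn2real_1 enn2real_mono infinity_ennreal_def top.not_eq_extremum)

lemma ell_norm_finite_set:
  assumes "finite A" "p \<noteq> \<infinity>"
  shows "ell_norm p A x = ennreal ((\<Sum>k\<in>A. \<bar>x k\<bar> powr enn2real p) powr (1 / enn2real p))"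
  using assms by (simp add: ell_norm_def Let_def sum_nonneg)

text \<open>Serves for the outer norm of a perturbation that lives on one level; this is why its
  Besov norm does not depend on the outer exponent.\<close>

lemma ell_norm_single:
  assumes "1 \<le> p" "i \<in> A" "\<And>k. k \<in> A \<Longrightarrow> k \<noteq> i \<Longrightarrow> x k = 0"
  shows "ell_norm p A x = ennreal \<bar>x i\<bar>"
proof (cases "p = \<infinity>")
  case True
  have "(SUP k\<in>A. ennreal \<bar>x k\<bar>) = ennreal \<bar>x i\<bar>"
  proof (rule antisym)
    show "(SUP k\<in>A. ennreal \<bar>x k\<bar>) \<le> ennreal \<bar>x i\<bar>"
      by (rule SUP_least) (metis assms(3) abs_ge_zero abs_zero ennreal_leI order_refl)
    show "ennreal \<bar>x i\<bar> \<le> (SUP k\<in>A. ennreal \<bar>x k\<bar>)"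
      using assms(2) by (rule SUP_upper)
  qed
  then show ?thesis using True by (simp add: ell_norm_def)
next
  case False
  have "(\<Sum>\<^sub>\<infinity>k\<in>A. ennreal (\<bar>x k\<bar> powr enn2real p)) = ennreal (\<bar>x i\<bar> powr enn2real p)"
    by (subst infsum_ennreal_remove[OF assms(2)], subst infsum_0) (auto simp: assms(3))
  then show ?thesis
    using False enn2real_ge_1[OF assms(1) False] by (simp add: ell_norm_def powr_powr)
qed

lemma ell_norm_cong: "(\<And>k. k \<in> A \<Longrightarrow> x k = y k) \<Longrightarrow> ell_norm p A x = ell_norm p A y"
  by (simp add: ell_norm_def cong: infsum_cong)

text \<open>Shows without a triangle inequality that a perturbation on one level stays in the Besov
  space: apart from the entry \<open>i\<close>, which is finite, both norms are formed from the same
  terms.\<close>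

lemma ell_norm_change_one_finite:
  assumes "ell_norm p UNIV x < \<infinity>" "\<And>k. k \<noteq> i \<Longrightarrow> y k = x k"
  shows "ell_norm p UNIV y < \<infinity>"
proof (cases "p = \<infinity>")
  case True
  have "(SUP k. ennreal \<bar>y k\<bar>) \<le> max (ennreal \<bar>y i\<bar>) (SUP k. ennreal \<bar>x k\<bar>)"
  proof (rule SUP_least)
    fix k
    show "ennreal \<bar>y k\<bar> \<le> max (ennreal \<bar>y i\<bar>) (SUP k. ennreal \<bar>x k\<bar>)"
    proof (cases "k = i")
      case False
      have "ennreal \<bar>x k\<bar> \<le> (SUP k. ennreal \<bar>x k\<bar>)" by (rule SUP_upper) simp
      with assms(2)[OF False] show ?thesis by (simp add: le_max_iff_disj)
    qed simp
  qed
  also have "\<dots> < \<infinity>"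
    using assms(1) True by (simp add: ell_norm_def max_def)
  finally show ?thesis using True by (simp add: ell_norm_def)
next
  case False
  let ?X = "\<lambda>z k. ennreal (\<bar>z k\<bar> powr enn2real p)"
  have "(\<Sum>\<^sub>\<infinity>k\<in>UNIV - {i}. ?X y k) = (\<Sum>\<^sub>\<infinity>k\<in>UNIV - {i}. ?X x k)"
    by (rule infsum_cong) (simp add: assms(2))
  moreover have "(\<Sum>\<^sub>\<infinity>k. ?X x k) \<noteq> \<infinity>"
    using assms(1) False by (auto simp: ell_norm_def Let_def split: if_splits)
  ultimately have "(\<Sum>\<^sub>\<infinity>k. ?X y k) \<noteq> \<infinity>"
    using infsum_ennreal_remove[of i UNIV "?X y"] infsum_ennreal_remove[of i UNIV "?X x"] by auto
  then show ?thesis using False by (simp add: ell_norm_def Let_def)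
qed

text \<open>Allows the error to be estimated from below on a single level.\<close>

lemma ell_norm_1_ge:
  assumes "i \<in> A"
  shows "ennreal \<bar>x i\<bar> \<le> ell_norm 1 A x"
proof -
  have "(\<Sum>\<^sub>\<infinity>k\<in>A. ennreal \<bar>x k\<bar>) \<ge> ennreal \<bar>x i\<bar>"
    by (subst infsum_ennreal_remove[OF assms]) simp
  then show ?thesis
    by (auto simp: ell_norm_def Let_def less_top)
qed

text \<open>A crude substitute for Minkowski's inequality: the constant is irrelevant for the lower
  bound on the worst case error.\<close>

lemma ell_norm_diff_le:
  assumes "finite A" "1 \<le> p" "p \<noteq> \<infinity>"
    and "enn2real (ell_norm p A x) \<le> M" "enn2real (ell_norm p A y) \<le> M"
  shows "enn2real (ell_norm p A (\<lambda>k. x k - y k)) \<le> 4 * M"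
proof -
  define r where "r = enn2real p"
  have r: "1 \<le> r" unfolding r_def using enn2real_ge_1 assms(2,3) .
  define S where "S z = (\<Sum>k\<in>A. \<bar>z k\<bar> powr r)" for z :: "'a \<Rightarrow> real"
  have eq: "enn2real (ell_norm p A z) = S z powr (1 / r)" for z
    by (simp add: ell_norm_finite_set[OF assms(1,3)] S_def r_def)
  have S0: "0 \<le> S z" for z by (simp add: S_def sum_nonneg)
  have M: "0 \<le> M" using assms(4) by (meson enn2real_nonneg order_trans)
  have le: "S z \<le> M powr r" if "enn2real (ell_norm p A z) \<le> M" for z
  proof -
    have "(S z powr (1 / r)) powr r \<le> M powr r"
      using that r by (intro powr_mono2) (auto simp: eq)
    then show ?thesis using r S0[of z] by (simp add: powr_powr)
  qed
  have "\<bar>s - t\<bar> powr r \<le> 2 powr r * (\<bar>s\<bar> powr r + \<bar>t\<bar> powr r)" for s t :: real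
  proof -
    have "\<bar>s - t\<bar> powr r \<le> (2 * max \<bar>s\<bar> \<bar>t\<bar>) powr r"
      using r by (intro powr_mono2) auto
    also have "\<dots> = 2 powr r * max \<bar>s\<bar> \<bar>t\<bar> powr r"
      by (simp add: powr_mult)
    also have "\<dots> \<le> 2 powr r * (\<bar>s\<bar> powr r + \<bar>t\<bar> powr r)"
      by (intro mult_left_mono) (auto simp: max_def)
    finally show ?thesis .
  qed
  then have "S (\<lambda>k. x k - y k) \<le> 2 powr r * (S x + S y)"
    unfolding S_def sum_distrib_left sum.distrib[symmetric] by (intro sum_mono)
  also have "\<dots> \<le> 2 powr r * (2 * M powr r)"
    using le[OF assms(4)] le[OF assms(5)] by (intro mult_left_mono) auto
  \<comment> \<open>Since \<open>1 \<le> r\<close>, the factor 2 is at most \<open>2 powr r\<close>;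
    the two such factors combine to \<open>4 powr r\<close>, whose root is the constant 4.\<close>
  also have "\<dots> \<le> 2 powr r * (2 powr r * M powr r)"
    using powr_mono[OF r, of 2] by (intro mult_left_mono mult_right_mono) auto
  also have "\<dots> = (4 * M) powr r"
    using M by (simp flip: powr_mult)
  finally have "S (\<lambda>k. x k - y k) powr (1 / r) \<le> ((4 * M) powr r) powr (1 / r)"
    using r S0 by (intro powr_mono2) auto
  then show ?thesis using r M by (simp add: eq powr_powr)
qed

lemma ell_norm_const:
  assumes "finite A" "A \<noteq> {}" "1 \<le> p" "p \<noteq> \<infinity>" "0 \<le> c"
  shows "ell_norm p A (\<lambda>k. c) = ennreal (c * real (card A) powr (1 / enn2real p))"
proof -
  have "(c powr enn2real p) powr (1 / enn2real p) = c"
    using enn2real_ge_1[OF assms(3,4)] assms(5) by (simp add: powr_powr)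
  then show ?thesis
    using assms by (simp add: ell_norm_finite_set powr_mult mult.commute)
qed


section \<open>Perturbations of a single level\<close>

text \<open>The extension chosen by \<open>pairing\<close> depends on \<open>v\<close> but not on
  the functional.\<close>

lemma pairing_diff: "pairing m \<Omega> (f - g) v = pairing m \<Omega> f v - pairing m \<Omega> g v"
  by (simp add: pairing_def)

text \<open>The outer sequence has at most one nonzero entry, and the inner norm is that of a
  constant vector. The case \<open>c = 0\<close> is included for the zero functional.\<close>

lemma besov_norm_single_level:
  fixes \<Omega> :: "'n::finite region"
  assumes "1 \<le> p" "p \<noteq> \<infinity>" "1 \<le> q" "finite (\<Lambda> j)" "\<Lambda> j \<noteq> {}" "0 \<le> c"
    and "\<And>i k. k \<in> \<Lambda> i \<Longrightarrow> pairing m \<Omega> f (\<psi> (i, k)) = (if i = j then c else 0)"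
  shows "besov_norm m \<Omega> \<Lambda> \<psi> s p q f =
    ennreal (2 powr (real j * s) * 2 powr (real j * real CARD('n) * (1 / 2 - enn2real (1 / p)))
      * (c * real (card (\<Lambda> j)) powr (1 / enn2real p)))"
proof -
  have "ell_norm p (\<Lambda> i) (Q_coeff m \<Omega> \<psi> i f) = 0" if "i \<noteq> j" for i
  proof -
    have "ell_norm p (\<Lambda> i) (Q_coeff m \<Omega> \<psi> i f) = ell_norm p (\<Lambda> i) (\<lambda>k. 0)"
      by (rule ell_norm_cong) (simp add: Q_coeff_def assms(7) that)
    then show ?thesis
      using assms(2) by (simp add: ell_norm_def infsum_0)
  qed
  moreover have "ell_norm p (\<Lambda> j) (Q_coeff m \<Omega> \<psi> j f) = ell_norm p (\<Lambda> j) (\<lambda>k. c)"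
    by (rule ell_norm_cong) (simp add: Q_coeff_def assms(7))
  ultimately show ?thesis
    using assms unfolding besov_norm_def
    by (subst ell_norm_single[where i = j]) (auto simp: ell_norm_const abs_mult)
qed

lemma besov_norm_1_ge_level:
  fixes \<Omega> :: "'n::finite region"
  shows "ennreal (2 powr (real j * s) * 2 powr (real j * real CARD('n) * (1 / 2 - enn2real (1 / p)))
      * enn2real (ell_norm p (\<Lambda> j) (Q_coeff m \<Omega> \<psi> j f))) \<le> besov_norm m \<Omega> \<Lambda> \<psi> s p 1 f"
  unfolding besov_norm_def by (rule order_trans[OF _ ell_norm_1_ge[of j]]) auto

lemma enn2real_one_divide: "1 \<le> p \<Longrightarrow> p \<noteq> \<infinity> \<Longrightarrow> enn2real (1 / p) = 1 / enn2real p"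
proof (cases p)
  case (real r)
  moreover assume "1 \<le> p"
  ultimately have "0 < r" by (cases "r = 0") auto
  with real show ?thesis
    by (simp add: divide_ennreal flip: ennreal_1)
qed simp

text \<open>Add to \<open>fbar\<close> the functional of \<open>c\<close> times the sum of the
  \<open>\<phi>\<close> on level \<open>j\<close>. Biorthogonality yields the coefficients, and the
  norm stays finite because the other levels are untouched.\<close>

lemma level_perturbation:
  fixes \<Omega> :: "'n::finite region" and \<Lambda> :: "nat \<Rightarrow> 'k set" and \<phi> \<phi>t :: "nat \<times> 'k \<Rightarrow> real ^ 'n \<Rightarrow> real"
  assumes "admissible_region \<Omega>" and fin: "\<And>j. finite (\<Lambda> j)"
    and \<phi>: "\<And>j k. k \<in> \<Lambda> j \<Longrightarrow> \<phi> (j, k) \<in> L2 \<Omega>"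
    and \<phi>t: "\<And>j k. k \<in> \<Lambda> j \<Longrightarrow> \<phi>t (j, k) \<in> L2 \<Omega>"
    and closed: "\<And>j k. k \<in> \<Lambda> j \<Longrightarrow> \<phi>t (j, k) \<in> C_closed m \<Omega>"
    and dual: "\<And>j' k' j k. k' \<in> \<Lambda> j' \<Longrightarrow> k \<in> \<Lambda> j \<Longrightarrow>
           L2_inner \<Omega> (\<phi> (j', k')) (\<phi>t (j, k)) = (if j' = j \<and> k' = k then 1 else 0)"
    and fbar: "fbar \<in> besov_space m \<Omega> \<Lambda> \<phi>t s p q"
  obtains f where "f \<in> besov_space m \<Omega> \<Lambda> \<phi>t s p q"
    and "\<And>i k. k \<in> \<Lambda> i \<Longrightarrow> pairing m \<Omega> (f - fbar) (\<phi>t (i, k)) = (if i = j then c else 0)"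
proof
  define h where "h x = (\<Sum>k\<in>\<Lambda> j. c * \<phi> (j, k) x)" for x
  define f where "f = (\<lambda>u. fbar u + functional_of m \<Omega> h u)"
  have h: "integrable (lebesgue_on (cell \<Omega>)) h"
    unfolding h_def using integrable_L2[OF assms(1) \<phi>]
    by (intro Bochner_Integration.integrable_sum integrable_mult_right)
  have inner: "L2_inner \<Omega> h (\<phi>t (i, k)) = (if i = j then c else 0)" if "k \<in> \<Lambda> i" for i k
  proof -
    have "L2_inner \<Omega> h (\<phi>t (i, k)) =
        (\<integral>x. (\<Sum>l\<in>\<Lambda> j. c * (\<phi> (j, l) x * \<phi>t (i, k) x)) \<partial>lebesgue_on (cell \<Omega>))"
      by (simp add: L2_inner_def h_def sum_distrib_right mult.assoc)
    also have "\<dots> = (\<Sum>l\<in>\<Lambda> j. c * L2_inner \<Omega> (\<phi> (j, l)) (\<phi>t (i, k)))"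
      unfolding L2_inner_def using \<phi> \<phi>t[OF that]
      by (subst Bochner_Integration.integral_sum) (auto intro!: integrable_mult_L2)
    \<comment> \<open>By duality only \<open>l = k\<close> on the level \<open>i = j\<close> can
      contribute, and there \<open>k\<close> does belong to the range of summation.\<close>
    also have "\<dots> = (\<Sum>l\<in>\<Lambda> j. if l = k then (if i = j then c else 0) else 0)"
      by (intro sum.cong) (auto simp: dual that)
    also have "\<dots> = (if i = j then c else 0)"
      using that fin by auto
    finally show ?thesis .
  qed
  show pairing: "pairing m \<Omega> (f - fbar) (\<phi>t (i, k)) = (if i = j then c else 0)" if "k \<in> \<Lambda> i" for i k
    using pairing_functional_of[OF closed[OF that], of h] inner[OF that]
    by (simp add: pairing_def f_def)
  have "f \<in> distributions m \<Omega>"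
    unfolding f_def
    using fbar by (intro add_functional_of_in_distributions assms(1) h) (simp add: besov_space_def)
  moreover have "besov_norm m \<Omega> \<Lambda> \<phi>t s p q f < \<infinity>"
    unfolding besov_norm_def
  proof (rule ell_norm_change_one_finite[where i = j])
    fix i assume "i \<noteq> j"
    then have "ell_norm p (\<Lambda> i) (Q_coeff m \<Omega> \<phi>t i f) = ell_norm p (\<Lambda> i) (Q_coeff m \<Omega> \<phi>t i fbar)"
      using pairing[of _ i] by (intro ell_norm_cong) (simp add: Q_coeff_def pairing_diff)
    then show "2 powr (real i * s) * 2 powr (real i * real CARD('n) * (1 / 2 - enn2real (1 / p)))
        * enn2real (ell_norm p (\<Lambda> i) (Q_coeff m \<Omega> \<phi>t i f)) =
      2 powr (real i * s) * 2 powr (real i * real CARD('n) * (1 / 2 - enn2real (1 / p)))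
        * enn2real (ell_norm p (\<Lambda> i) (Q_coeff m \<Omega> \<phi>t i fbar))"
      by simp
  qed (use fbar in \<open>simp add: besov_space_def besov_norm_def\<close>)
  ultimately show "f \<in> besov_space m \<Omega> \<Lambda> \<phi>t s p q"
    by (simp add: besov_space_def)
qed


section \<open>The lower bound\<close>

text \<open>The data \<open>F f\<^sub>2\<close> are admissible for \<open>f\<^sub>1\<close> and for
  \<open>f\<^sub>2\<close>, so one reconstruction must be close to both. On level \<open>j\<close>
  this bounds their distance by 4 times the weighted error, whence the division by 4.\<close>

lemma worst_case_error_ge:
  fixes \<Omega> :: "'n::finite region"
  assumes "finite (\<Lambda> j)" "1 \<le> p" "p \<noteq> \<infinity>"
    and "f\<^sub>1 \<in> K" "f\<^sub>2 \<in> K" "norm (F f\<^sub>1 - F f\<^sub>2) \<le> \<delta>"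
  shows "ennreal (2 powr (real j * real CARD('n) * (1 / 2 - enn2real (1 / p)))
      * enn2real (ell_norm p (\<Lambda> j) (Q_coeff m \<Omega> \<psi> j (f\<^sub>1 - f\<^sub>2))) / 4)
    \<le> worst_case_error (besov_norm m \<Omega> \<Lambda> \<psi> 0 p 1) K F R \<delta>"
    (is "_ \<le> ?W")
proof (cases ?W)
  \<comment> \<open>An infinite worst case error leaves nothing to show.\<close>
  case (real W)
  define w where "w = (2::real) powr (real j * real CARD('n) * (1 / 2 - enn2real (1 / p)))"
  define e where "e f = enn2real (ell_norm p (\<Lambda> j) (Q_coeff m \<Omega> \<psi> j f))" for f
  define g where "g = F f\<^sub>2"
  have "0 < w" by (simp add: w_def)
  have le: "e (f - R g) \<le> W / w" if "f \<in> K" "norm (F f - g) \<le> \<delta>" for f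
  proof -
    have "ennreal (w * e (f - R g)) \<le> besov_norm m \<Omega> \<Lambda> \<psi> 0 p 1 (f - R g)"
      using besov_norm_1_ge_level[of j 0 p \<Lambda> m \<Omega> \<psi> "f - R g"] unfolding w_def e_def by simp
    also have "\<dots> \<le> ?W"
      unfolding worst_case_error_def by (rule SUP_upper2[of "(f, g)"]) (use that in auto)
    finally show ?thesis using real \<open>0 < w\<close> by (simp add: field_simps)
  qed
  \<comment> \<open>Makes the exact data admissible for \<open>f\<^sub>2\<close> itself, where the
    noise is 0.\<close>
  have "0 \<le> \<delta>"
    using assms(6) norm_ge_zero order_trans by blast
  then have "e (f\<^sub>1 - R g) \<le> W / w" "e (f\<^sub>2 - R g) \<le> W / w"
    using le[of f\<^sub>1] le[of f\<^sub>2] assms(4-6) by (simp_all add: g_def)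
  from ell_norm_diff_le[OF assms(1-3) this[unfolded e_def]]
  have "e (f\<^sub>1 - f\<^sub>2) \<le> 4 * (W / w)"
    unfolding e_def by (simp add: Q_coeff_def pairing_diff cong: ell_norm_cong)
  then have "w * e (f\<^sub>1 - f\<^sub>2) / 4 \<le> W"
    using \<open>0 < w\<close> by (simp add: field_simps)
  then show ?thesis using real by (simp add: ennreal_leI w_def e_def)
qed simp

theorem theorem4p5:
  fixes \<Omega> :: "'n::finite region"
    and sbar :: enat
    and \<Lambda> :: "nat \<Rightarrow> 'k set"
    and C\<^sub>\<Lambda> :: real
    and \<phi> \<phi>t :: "nat \<times> 'k \<Rightarrow> real ^ 'n \<Rightarrow> real"
    and p q :: ennreal
    and a s L\<^sub>2 \<rho> :: real
    and D :: "'n functional set"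
    and F :: "'n functional \<Rightarrow> 'y::banach"
    and fbar :: "'n functional"
  assumes "admissible_region \<Omega>"
    and "1 \<le> C\<^sub>\<Lambda>"
    and "\<And>j. finite (\<Lambda> j)"
    and "\<And>j. 2 ^ (j * CARD('n)) \<le> card (\<Lambda> j)"
    and "\<And>j. real (card (\<Lambda> j)) \<le> C\<^sub>\<Lambda> * 2 ^ (j * CARD('n))"
    and "L2_frame \<Omega> (SIGMA j:UNIV. \<Lambda> j) \<phi>"
    and "L2_frame \<Omega> (SIGMA j:UNIV. \<Lambda> j) \<phi>t"
    and "\<And>j' k' j k. k' \<in> \<Lambda> j' \<Longrightarrow> k \<in> \<Lambda> j \<Longrightarrow>
           L2_inner \<Omega> (\<phi> (j', k')) (\<phi>t (j, k)) = (if j' = j \<and> k' = k then 1 else 0)"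
    and "1 \<le> sbar"
    and "\<And>j k. k \<in> \<Lambda> j \<Longrightarrow> \<phi>t (j, k) \<in> C_closed sbar \<Omega>"
    and "1 \<le> p" and "p \<le> 2"
    and "D \<noteq> {}"
    and "convex_functionals D"
    and "D \<subseteq> besov_space sbar \<Omega> \<Lambda> \<phi>t 0 p 1"
    and "L2_riesz_basis \<Omega> (SIGMA j:UNIV. \<Lambda> j) \<phi>t"
    and "0 < a" and "0 < L\<^sub>2"
    and "\<And>f\<^sub>1 f\<^sub>2. f\<^sub>1 \<in> D \<Longrightarrow> f\<^sub>2 \<in> D \<Longrightarrow>
           ennreal (norm (F f\<^sub>1 - F f\<^sub>2))
             \<le> ennreal L\<^sub>2 * besov_norm sbar \<Omega> \<Lambda> \<phi>t (- a) 2 1 (f\<^sub>1 - f\<^sub>2)"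
    and "1 \<le> q" and "0 < s" and "0 < \<rho>"
    and "fbar \<in> besov_space sbar \<Omega> \<Lambda> \<phi>t s p q"
    and "besov_ball sbar \<Omega> \<Lambda> \<phi>t s p q fbar \<rho> \<subseteq> D"
  shows "\<not> (\<exists>R :: 'y \<Rightarrow> 'n functional.
           (\<forall>g. R g \<in> besov_space sbar \<Omega> \<Lambda> \<phi>t 0 p 1) \<and>
           ((\<lambda>\<delta>. worst_case_error (besov_norm sbar \<Omega> \<Lambda> \<phi>t 0 p 1)
                    (besov_ball sbar \<Omega> \<Lambda> \<phi>t s p q fbar \<rho>) F R \<delta>
                  / ennreal (\<rho> powr (a / (s + a)) * \<delta> powr (s / (s + a)))) \<longlongrightarrow> 0)
             (at_right 0))"
proof
  let ?E = "\<lambda>R \<delta>. worst_case_error (besov_norm sbar \<Omega> \<Lambda> \<phi>t 0 p 1)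
              (besov_ball sbar \<Omega> \<Lambda> \<phi>t s p q fbar \<rho>) F R \<delta>"
  let ?G = "\<lambda>R \<delta>. ?E R \<delta> / ennreal (\<rho> powr (a / (s + a)) * \<delta> powr (s / (s + a)))"
  define \<delta> where "\<delta> j = L\<^sub>2 * (\<rho> * 2 powr (- real j * (s + a)))" for j
  define r where "r = enn2real p"
  have p: "p \<noteq> \<infinity>"
    using assms(12) by (auto simp: top_unique)
  then have inv: "enn2real (1 / p) = 1 / r" and "1 \<le> r"
    using enn2real_ge_1 enn2real_one_divide assms(11) by (auto simp: r_def)
  have "r \<le> 2"
    using enn2real_mono[OF assms(12)] by (simp add: r_def)
  have half: "enn2real (1 / 2) = 1 / 2"
    using enn2real_one_divide[of 2] by simp
  have \<phi>: "\<phi> (j, k) \<in> L2 \<Omega>" and \<phi>t: "\<phi>t (j, k) \<in> L2 \<Omega>" if "k \<in> \<Lambda> j" for j k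
    using assms(6,7) that by (auto simp: L2_frame_def)

  \<comment> \<open>Lower bound for the worst case error at noise level
    \<open>\<delta> j\<close>\<close>
  have low: "ennreal (\<rho> * 2 powr (- real j * s) / 4) \<le> ?E R (\<delta> j)" for R j
  proof -
    \<comment> \<open>\<open>w\<close> is the dimensional weight of level \<open>j\<close> in the
      norms with inner exponent \<open>p\<close>. The amplitude \<open>c\<close> is chosen so that
      the perturbation has norm exactly \<open>\<rho>\<close> in the space of the ball.\<close>
    define w where "w = (2::real) powr (real j * real CARD('n) * (1 / 2 - 1 / r))"
    define N where "N = real (card (\<Lambda> j))"
    define c where "c = \<rho> * 2 powr (- real j * s) / (w * N powr (1 / r))"
    have N: "2 powr (real j * real CARD('n)) \<le> N"
    proof -
      have "real (2 ^ (j * CARD('n))) \<le> real (card (\<Lambda> j))"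
        using assms(4) of_nat_le_iff by blast
      then show ?thesis by (simp add: N_def powr_realpow flip: of_nat_mult)
    qed
    then have "0 < N" by (rule less_le_trans[rotated]) simp
    then have ne: "\<Lambda> j \<noteq> {}" by (auto simp: N_def)
    have "0 < w" by (simp add: w_def)
    have c: "0 \<le> c" "w * (c * N powr (1 / r)) = \<rho> * 2 powr (- real j * s)"
      using \<open>0 < w\<close> \<open>0 < N\<close> \<open>0 < \<rho>\<close> by (simp_all add: c_def)
    obtain f where f: "f \<in> besov_space sbar \<Omega> \<Lambda> \<phi>t s p q"
      and pairing: "\<And>i k. k \<in> \<Lambda> i \<Longrightarrow> pairing sbar \<Omega> (f - fbar) (\<phi>t (i, k)) = (if i = j then c else 0)"
      using level_perturbation[OF assms(1,3) \<phi> \<phi>t assms(10,8,23)] by blast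
    note norms = besov_norm_single_level[where \<Lambda> = \<Lambda> and j = j and f = "f - fbar", OF _ _ _ assms(3) ne c(1) pairing]
    have "besov_norm sbar \<Omega> \<Lambda> \<phi>t s p q (f - fbar) =
        ennreal (2 powr (real j * s) * w * (c * N powr (1 / r)))"
      using norms[OF assms(11) p assms(20), of s] unfolding inv r_def[symmetric] w_def N_def .
    also have "\<dots> = ennreal (2 powr (real j * s) * (\<rho> * 2 powr (- real j * s)))"
      by (simp only: c(2)[symmetric] mult.assoc)
    also have "\<dots> = ennreal \<rho>"
      by (simp add: powr_minus field_simps)
    finally have f_ball: "f \<in> besov_ball sbar \<Omega> \<Lambda> \<phi>t s p q fbar \<rho>"
      using f by (simp add: besov_ball_def)
    \<comment> \<open>The zero functional is a perturbation of amplitude 0.\<close>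
    have "besov_norm sbar \<Omega> \<Lambda> \<phi>t s p q (fbar - fbar) = 0"
      by (subst besov_norm_single_level[where \<Lambda> = \<Lambda> and j = j and c = 0, OF assms(11) p assms(20,3) ne])
        (simp_all add: pairing_diff)
    then have fbar_ball: "fbar \<in> besov_ball sbar \<Omega> \<Lambda> \<phi>t s p q fbar \<rho>"
      using assms(23) by (simp add: besov_ball_def)
    have "norm (F f - F fbar) \<le> \<delta> j"
    proof -
      \<comment> \<open>Passing from the \<open>p\<close>-norm to the 2-norm of a constant vector of
        length \<open>N\<close> costs the factor \<open>N powr (1 / 2 - 1 / r)\<close>, which is
        compared with the weight \<open>w\<close>.\<close>
      have "c * N powr (1 / 2) = \<rho> * 2 powr (- real j * s) * (N powr (1 / 2 - 1 / r) / w)"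
        unfolding c_def powr_diff by (simp add: ac_simps)
      also have "N powr (1 / 2 - 1 / r) / w \<le> 1"
      proof -
        \<comment> \<open>The exponent is not positive because \<open>r \<le> 2\<close>, so the
          lower bound on \<open>N\<close> becomes an upper bound on the power.\<close>
        have "N powr (1 / 2 - 1 / r) \<le> (2 powr (real j * real CARD('n))) powr (1 / 2 - 1 / r)"
          using N \<open>1 \<le> r\<close> \<open>r \<le> 2\<close> by (intro powr_mono2') (auto simp: field_simps)
        also have "\<dots> = w" by (simp add: w_def powr_powr)
        finally show ?thesis using \<open>0 < w\<close> by simp
      qed
      finally have "c * N powr (1 / 2) \<le> \<rho> * 2 powr (- real j * s)"
        using \<open>0 < \<rho>\<close> by (simp add: mult_left_le)
      then have "2 powr (- real j * a) * (c * N powr (1 / 2)) \<le>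
          2 powr (- real j * a) * (\<rho> * 2 powr (- real j * s))"
        by (rule mult_left_mono) simp
      also have "\<dots> = \<rho> * 2 powr (- real j * (s + a))"
      proof -
        have "- real j * (s + a) = - real j * a + - real j * s" by (simp add: algebra_simps)
        then show ?thesis by (simp only: powr_add ac_simps)
      qed
      finally have le: "2 powr (- real j * a) * (c * N powr (1 / 2)) \<le> \<rho> * 2 powr (- real j * (s + a))" .
      \<comment> \<open>For inner exponent 2 the dimensional weight is 1.\<close>
      have "besov_norm sbar \<Omega> \<Lambda> \<phi>t (- a) 2 1 (f - fbar) =
          ennreal (2 powr (- real j * a) * (c * N powr (1 / 2)))"
        using norms[of 2 1 "- a"] unfolding N_def half by simp
      also have "\<dots> \<le> ennreal (\<rho> * 2 powr (- real j * (s + a)))"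
        using le by (rule ennreal_leI)
      finally have "ennreal L\<^sub>2 * besov_norm sbar \<Omega> \<Lambda> \<phi>t (- a) 2 1 (f - fbar) \<le> ennreal (\<delta> j)"
        using assms(18,22) unfolding \<delta>_def by (subst ennreal_mult) (auto intro: mult_left_mono)
      then have "ennreal (norm (F f - F fbar)) \<le> ennreal (\<delta> j)"
        using assms(19)[of f fbar] assms(24) f_ball fbar_ball by (meson order_trans subsetD)
      then show ?thesis
        using assms(18,22) by (simp add: \<delta>_def)
    qed
    from worst_case_error_ge[where F = F and R = R and \<Lambda> = \<Lambda> and j = j and m = sbar and \<Omega> = \<Omega> and \<psi> = \<phi>t,
        OF assms(3,11) p f_ball fbar_ball this]
    have "ennreal (w * enn2real (ell_norm p (\<Lambda> j) (Q_coeff sbar \<Omega> \<phi>t j (f - fbar))) / 4)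
        \<le> ?E R (\<delta> j)"
      unfolding inv w_def .
    \<comment> \<open>All coefficients on level \<open>j\<close> equal \<open>c\<close>, so the
      choice of \<open>c\<close> evaluates the bound.\<close>
    moreover have "ell_norm p (\<Lambda> j) (Q_coeff sbar \<Omega> \<phi>t j (f - fbar)) = ell_norm p (\<Lambda> j) (\<lambda>k. c)"
      by (rule ell_norm_cong) (simp only: Q_coeff_def pairing refl if_True)
    then have "enn2real (ell_norm p (\<Lambda> j) (Q_coeff sbar \<Omega> \<phi>t j (f - fbar))) = c * N powr (1 / r)"
      unfolding ell_norm_const[OF assms(3) ne assms(11) p c(1)] N_def r_def by (simp add: c(1))
    ultimately show ?thesis by (simp only: c(2))
  qed

  \<comment> \<open>The ratio to the claimed rate along \<open>\<delta> j\<close>\<close>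
  define K where "K = 1 / (4 * L\<^sub>2 powr (s / (s + a)))"
  have "0 < K" using assms(18) by (simp add: K_def)
  have ratio: "ennreal K \<le> ?G R (\<delta> j)" for R j
  proof -
    have "s / (s + a) + a / (s + a) = 1"
      using assms(17,21) by (simp flip: add_divide_distrib)
    then have \<rho>s: "\<rho> powr (a / (s + a)) * \<rho> powr (s / (s + a)) = \<rho>"
      using assms(22) by (simp add: add.commute flip: powr_add)
    \<comment> \<open>The power \<open>s / (s + a)\<close> cancels the factor \<open>s + a\<close>
      in the exponent of 2, leaving the decay of the lower bound \<open>low\<close>.\<close>
    have \<delta>s: "\<delta> j powr (s / (s + a)) =
        L\<^sub>2 powr (s / (s + a)) * (\<rho> powr (s / (s + a)) * 2 powr (- real j * s))"
      using assms(17,18,21,22) by (simp add: \<delta>_def powr_mult powr_powr)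
    have eq: "\<rho> powr (a / (s + a)) * \<delta> j powr (s / (s + a)) =
        L\<^sub>2 powr (s / (s + a)) * (\<rho> * 2 powr (- real j * s))"
    proof -
      have "x * (y * (z * t)) = y * ((x * z) * t)" for x y z t :: real by (simp only: ac_simps)
      from this[of "\<rho> powr (a / (s + a))"] show ?thesis by (simp only: \<delta>s \<rho>s)
    qed
    have pos: "0 < \<rho> * 2 powr (- real j * s)" using assms(22) by simp
    \<comment> \<open>The common factor \<open>\<rho> * 2 powr (- real j * s)\<close> cancels;
      \<open>K\<close> is what remains, independent of \<open>j\<close> and
      \<open>R\<close>.\<close>
    have "ennreal K = ennreal (\<rho> * 2 powr (- real j * s) / 4) /
        ennreal (L\<^sub>2 powr (s / (s + a)) * (\<rho> * 2 powr (- real j * s)))"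
      using assms(18,22) by (subst divide_ennreal) (auto simp: K_def)
    also have "\<dots> \<le> ?G R (\<delta> j)"
      unfolding eq using low by (rule divide_right_mono_ennreal)
    finally show ?thesis .
  qed

  \<comment> \<open>Contradiction in the limit\<close>
  have "filterlim \<delta> (at_right 0) sequentially"
    unfolding filterlim_at
  proof
    have "\<delta> \<longlonglongrightarrow> L\<^sub>2 * (\<rho> * 0)"
      unfolding \<delta>_def
    proof (intro tendsto_intros)
      \<comment> \<open>A geometric sequence whose ratio is below 1 because \<open>s + a\<close> is
        positive.\<close>
      have "(\<lambda>j. (2 powr (- (s + a))) ^ j) \<longlonglongrightarrow> 0"
        using assms(17,21) by (intro LIMSEQ_realpow_zero) (auto simp: powr_less_one)
      moreover have "(2 powr (- (s + a))) ^ j = (2::real) powr (- real j * (s + a))" for j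
        by (simp add: powr_powr algebra_simps flip: powr_realpow)
      ultimately show "(\<lambda>j. 2 powr (- real j * (s + a))) \<longlonglongrightarrow> 0"
        by simp
    qed
    then show "\<delta> \<longlonglongrightarrow> 0" by simp
  qed (use assms(18,22) in \<open>simp add: \<delta>_def\<close>)
  moreover assume "\<exists>R. (\<forall>g. R g \<in> besov_space sbar \<Omega> \<Lambda> \<phi>t 0 p 1) \<and> (?G R \<longlongrightarrow> 0) (at_right 0)"
  then obtain R where "(?G R \<longlongrightarrow> 0) (at_right 0)" by blast
  ultimately have "(\<lambda>j. ?G R (\<delta> j)) \<longlonglongrightarrow> 0"
    by (rule filterlim_compose[rotated])
  \<comment> \<open>The bound \<open>ratio\<close> is uniform in \<open>j\<close>, so it survives in
    the limit, which would be 0.\<close>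
  then have "ennreal K \<le> 0"
    by (rule LIMSEQ_le_const) (use ratio in blast)
  with \<open>0 < K\<close> show False by simp
qed

end
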